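(* Let $\Lambda>0$. For a prime power $q$, let $\Gamma_q$ be a strongly regular graph with parameters $v=q^4$, $k=(q-1)^2(q^2+1)$, $\mu=(q-1)^2((q-1)^2+1)$, $\lambda=\mu+(q-1)^2+1-2q$ (whose restricted eigenvalues are $\rho=(q-1)^2$ and $\sigma=1-2q$). Then there are infinitely many prime powers $q$ such that for every integer $d$ with $0\le d\le\Lambda$, $$\mathrm{Rab}_{\geq}(\Gamma_q,d)<\lfloor \mathrm{Haem}_{\geq}(\Gamma_q,d)\rfloor.$$
   Context: A graph is strongly regular with parameters $(v,k,\lambda,\mu)$ if it has $v$ vertices, is $k$-regular, is neither complete nor edgeless, every two adjacent vertices have exactly $\lambda$ common neighbours, and every two distinct non-adjacent vertices have exactly $\mu$ common neighbours; restricted eigenvalues $\rho>\sigma$ are the roots of $t^2-(\lambda-\mu)t-(k-\mu)=0$. Strongly regular graphs with the parameters of $\Gamma_q$ exist for every prime power $q$ (Calderbank–Kantor, Example CY1). Both bounds below depend only on the parameters. $\mathrm{Haem}_{\geq}(\Gamma,d)=v\frac{d-\sigma}{k-\sigma}$; $R_\Gamma(x,y,d)=x(x+1)(v-y)-2xyk+(2x+\lambda-\mu+1)yd+y(y-1)\mu-yd^2$; $S_d=\{y\in\{d+1,\dots,v\}: R_\Gamma(x,y,d)\ge0\text{ for all integers }x\}$; $\mathrm{Rab}_{\geq}(\Gamma,d)=\max S_d$ if $S_d\ne\emptyset$, else $0$. *)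

theory Defs
  imports Complex_Main "HOL-Number_Theory.Prime_Powers" "Graph_Theory.Graph_Theory"
begin

text \<open>
  Finite simple graphs are the \<open>pair_graph\<close>s of the AFP entry \<open>Graph_Theory\<close>: an undirected
  edge \<open>uw\<close> is the pair of arcs \<open>(u, w)\<close>, \<open>(w, u)\<close>, so the out-degree of a vertex is its degree.
\<close>

definition common_nbrs :: "'a pair_pre_digraph \<Rightarrow> 'a \<Rightarrow> 'a \<Rightarrow> 'a set" where
  "common_nbrs G u w = {x \<in> pverts G. (u, x) \<in> parcs G \<and> (w, x) \<in> parcs G}"

definition regular_of :: "'a pair_pre_digraph \<Rightarrow> nat \<Rightarrow> bool" where
  "regular_of G k \<longleftrightarrow> (\<forall>u \<in> pverts G. out_degree (with_proj G) u = k)"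

definition adj_common :: "'a pair_pre_digraph \<Rightarrow> nat \<Rightarrow> bool" where
  "adj_common G l \<longleftrightarrow>
     (\<forall>u \<in> pverts G. \<forall>w \<in> pverts G. (u, w) \<in> parcs G \<longrightarrow> card (common_nbrs G u w) = l)"

definition nonadj_common :: "'a pair_pre_digraph \<Rightarrow> nat \<Rightarrow> bool" where
  "nonadj_common G m \<longleftrightarrow>
     (\<forall>u \<in> pverts G. \<forall>w \<in> pverts G.
        u \<noteq> w \<longrightarrow> (u, w) \<notin> parcs G \<longrightarrow> card (common_nbrs G u w) = m)"

definition strongly_regular ::
  "'a pair_pre_digraph \<Rightarrow> nat \<Rightarrow> nat \<Rightarrow> nat \<Rightarrow> nat \<Rightarrow> bool" where
  "strongly_regular G v k l m \<longleftrightarrow>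
     pair_graph G \<and>
     card (pverts G) = v \<and>
     regular_of G k \<and>
     \<not> complete_digraph (card (pverts G)) (with_proj G) \<and>
     parcs G \<noteq> {} \<and>
     adj_common G l \<and>
     nonadj_common G m"

text \<open>
  The parameters of a strongly regular graph as functions of the graph. They are uniquely
  determined, because such a graph has a vertex, an edge, and a pair of distinct non-adjacent
  vertices. They are integers, since differences such as \<open>\<lambda> - \<mu>\<close> may be negative.
\<close>

definition srg_v :: "'a pair_pre_digraph \<Rightarrow> int" where
  "srg_v G = int (card (pverts G))"

definition srg_k :: "'a pair_pre_digraph \<Rightarrow> int" where
  "srg_k G = int (THE k. regular_of G k)"

definition srg_lambda :: "'a pair_pre_digraph \<Rightarrow> int" where
  "srg_lambda G = int (THE l. adj_common G l)"

definition srg_mu :: "'a pair_pre_digraph \<Rightarrow> int" where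
  "srg_mu G = int (THE m. nonadj_common G m)"

definition restricted_eigenvalues :: "'a pair_pre_digraph \<Rightarrow> real set" where
  "restricted_eigenvalues G =
     {t. t\<^sup>2 - real_of_int (srg_lambda G - srg_mu G) * t - real_of_int (srg_k G - srg_mu G) = 0}"

definition srg_rho :: "'a pair_pre_digraph \<Rightarrow> real" where
  "srg_rho G = Max (restricted_eigenvalues G)"

definition srg_sigma :: "'a pair_pre_digraph \<Rightarrow> real" where
  "srg_sigma G = Min (restricted_eigenvalues G)"

definition Haem_ge :: "'a pair_pre_digraph \<Rightarrow> int \<Rightarrow> real" where
  "Haem_ge G d =
     real_of_int (srg_v G) *
       ((real_of_int d - srg_sigma G) / (real_of_int (srg_k G) - srg_sigma G))"

definition R_poly :: "'a pair_pre_digraph \<Rightarrow> int \<Rightarrow> int \<Rightarrow> int \<Rightarrow> int" where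
  "R_poly G x y d =
     x * (x + 1) * (srg_v G - y) - 2 * x * y * srg_k G
     + (2 * x + srg_lambda G - srg_mu G + 1) * y * d
     + y * (y - 1) * srg_mu G - y * d\<^sup>2"

definition Rab_set :: "'a pair_pre_digraph \<Rightarrow> int \<Rightarrow> int set" where
  "Rab_set G d = {y \<in> {d + 1..srg_v G}. \<forall>x. R_poly G x y d \<ge> 0}"

definition Rab_ge :: "'a pair_pre_digraph \<Rightarrow> int \<Rightarrow> int" where
  "Rab_ge G d = (if Rab_set G d \<noteq> {} then Max (Rab_set G d) else 0)"

end

theory Submission
  imports Defs
begin

text \<open>
  Write \<open>H = Haem_ge \<Gamma> d\<close>. For \<open>0 < y < v\<close> and an integer \<open>x\<close>,
  the number \<open>(v - y) R(x, y, d)\<close> is the sum of a term having the sign of \<open>H - y\<close>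
  and of the product of two integers that differ by \<open>v - y\<close>. Choosing \<open>x\<close> as a
  quotient with remainder makes this product nonpositive, so no such \<open>y > H\<close> lies in
  \<open>Rab_set \<Gamma> d\<close>; neither does \<open>y = v\<close>, where \<open>R\<close> is linear in
  \<open>x\<close>. As soon as \<open>q \<ge> 2d + 4\<close>, we have \<open>\<lfloor>H\<rfloor> = 2q + d +
  3\<close>. At \<open>y = \<lfloor>H\<rfloor>\<close> the first term is positive but tiny, because
  \<open>H\<close> exceeds its floor only by about \<open>(2d + 2)/q\<close>, and for \<open>x = 2q + d -
  2\<close> the product outweighs it. So already \<open>\<lfloor>H\<rfloor>\<close> is missing from
  \<open>Rab_set \<Gamma> d\<close>.
\<close>

lemma strongly_regular_params:
  assumes "strongly_regular G v k l m" and "v > 0"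
  shows "srg_v G = int v" "srg_k G = int k" "srg_lambda G = int l" "srg_mu G = int m"
proof -
  have G: "pair_graph G" and v: "card (pverts G) = v" and k: "regular_of G k"
    and l: "adj_common G l" and m: "nonadj_common G m" and ne: "parcs G \<noteq> {}"
    and nc: "\<not> complete_digraph (card (pverts G)) (with_proj G)"
    using assms unfolding strongly_regular_def by auto
  interpret pair_graph G by (fact G)
  show "srg_v G = int v"
    using v by (simp add: srg_v_def)
  obtain u where "u \<in> pverts G"
    using v \<open>v > 0\<close> by (metis card.empty ex_in_conv less_irrefl)
  then have "(THE k. regular_of G k) = k"
    using k by (intro the_equality) (auto simp: regular_of_def)
  then show "srg_k G = int k"
    by (simp add: srg_k_def)
  obtain a b where ab: "(a, b) \<in> parcs G"
    using ne by auto
  then have "a \<in> pverts G" "b \<in> pverts G"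
    by (auto dest: wellformed')
  then have "(THE l. adj_common G l) = l"
    using l ab by (intro the_equality) (auto simp: adj_common_def)
  then show "srg_lambda G = int l"
    by (simp add: srg_lambda_def)
  have "parcs G \<noteq> {(u, w). (u, w) \<in> pverts G \<times> pverts G \<and> u \<noteq> w}"
    using nc pair_finite_verts by (auto simp: complete_digraph_pair_def)
  moreover have "parcs G \<subseteq> {(u, w). (u, w) \<in> pverts G \<times> pverts G \<and> u \<noteq> w}"
    by (auto dest: wellformed' pair_no_loops)
  ultimately obtain c e where ce: "c \<in> pverts G" "e \<in> pverts G" "c \<noteq> e" "(c, e) \<notin> parcs G"
    by blast
  then have "(THE m. nonadj_common G m) = m"
    using m by (intro the_equality) (auto simp: nonadj_common_def)
  then show "srg_mu G = int m"
    by (simp add: srg_mu_def)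
qed

lemma Rab_ge_less:
  assumes "0 < h" and "\<And>y. h \<le> y \<Longrightarrow> y \<le> srg_v G \<Longrightarrow> \<exists>x. R_poly G x y d < 0"
  shows "Rab_ge G d < h"
proof (cases "Rab_set G d = {}")
  case True
  \<comment> \<open>On an empty set \<open>Rab_ge\<close> takes its default value 0, hence the
    assumption \<open>0 < h\<close>.\<close>
  then show ?thesis using assms(1) by (simp add: Rab_ge_def)
next
  case False
  have "finite (Rab_set G d)"
    by (rule finite_subset[of _ "{d + 1..srg_v G}"]) (auto simp: Rab_set_def)
  moreover have "y < h" if "y \<in> Rab_set G d" for y
    using that assms(2)[of y] unfolding Rab_set_def
    by (metis (mono_tags, lifting) atLeastAtMost_iff linorder_not_le mem_Collect_eq)
  ultimately show ?thesis
    using False by (simp add: Rab_ge_def)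
qed

text \<open>Both bounds depend on \<open>G\<close> only through its parameters, so all that follows
  is arithmetic in the integer \<open>q\<close>.\<close>

locale cy1_graph =
  fixes G :: "'a pair_pre_digraph" and q :: int
  assumes q_ge: "q \<ge> 2"
    and v_eq: "srg_v G = q ^ 4"
    and k_eq: "srg_k G = (q - 1)\<^sup>2 * (q\<^sup>2 + 1)"
    and mu_eq: "srg_mu G = (q - 1)\<^sup>2 * ((q - 1)\<^sup>2 + 1)"
    and lambda_eq: "srg_lambda G = srg_mu G + (q - 1)\<^sup>2 + 1 - 2 * q"
begin

lemma restricted_eigenvalues_eq:
  "restricted_eigenvalues G = {(real_of_int q - 1)\<^sup>2, 1 - 2 * real_of_int q}"
proof -
  have "t\<^sup>2 - real_of_int (srg_lambda G - srg_mu G) * t - real_of_int (srg_k G - srg_mu G)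
      = (t - (real_of_int q - 1)\<^sup>2) * (t - (1 - 2 * real_of_int q))" for t :: real
    unfolding lambda_eq k_eq mu_eq by (simp add: algebra_simps power2_eq_square)
  then show ?thesis
    by (auto simp: restricted_eigenvalues_def)
qed

lemma srg_rho_eq: "srg_rho G = (real_of_int q - 1)\<^sup>2"
  and srg_sigma_eq: "srg_sigma G = 1 - 2 * real_of_int q"
proof -
  have "1 - 2 * real_of_int q \<le> (real_of_int q - 1)\<^sup>2"
    using zero_le_power2[of "real_of_int q - 1"] q_ge by linarith
  then show "srg_rho G = (real_of_int q - 1)\<^sup>2" "srg_sigma G = 1 - 2 * real_of_int q"
    by (simp_all add: srg_rho_def srg_sigma_def restricted_eigenvalues_eq)
qed

text \<open>Since \<open>k - \<sigma> = q^2 * (q^2 - 2*q + 2)\<close>, a factor \<open>q^2\<close>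
  of \<open>v\<close> cancels. A quotient of integers remains, so its floor is an integer
  division.\<close>

lemma Haem_ge_eq:
  "Haem_ge G d = real_of_int (q\<^sup>2 * (d + 2 * q - 1)) / real_of_int (q\<^sup>2 - 2 * q + 2)"
proof -
  have k: "real_of_int (srg_k G) - srg_sigma G
      = (real_of_int q)\<^sup>2 * real_of_int (q\<^sup>2 - 2 * q + 2)"
    unfolding k_eq srg_sigma_eq by (simp add: algebra_simps power2_eq_square)
  have "Haem_ge G d = (real_of_int q)\<^sup>2 * ((real_of_int q)\<^sup>2 * (real_of_int d - srg_sigma G))
      / ((real_of_int q)\<^sup>2 * real_of_int (q\<^sup>2 - 2 * q + 2))"
    unfolding Haem_ge_def k v_eq by (simp add: power2_eq_square power4_eq_xxxx)
  also have "\<dots> = (real_of_int q)\<^sup>2 * (real_of_int d - srg_sigma G) / real_of_int (q\<^sup>2 - 2 * q + 2)"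
    using q_ge by (intro mult_divide_mult_cancel_left) simp
  finally show ?thesis
    by (simp add: srg_sigma_eq algebra_simps)
qed

lemma floor_Haem_ge:
  assumes "0 \<le> d" "2 * d + 4 \<le> q"
  shows "\<lfloor>Haem_ge G d\<rfloor> = 2 * q + d + 3"
proof -
  \<comment> \<open>The remainder of \<open>q^2 * (d + 2*q - 1)\<close> on division by
    \<open>q^2 - 2*q + 2\<close>, the quotient being \<open>2*q + d + 3\<close>.\<close>
  define r where "r = (2 * d + 2) * q - 6 - 2 * d"
  have "(2 * d + 2) * 4 \<le> (2 * d + 2) * q"
    using assms by (intro mult_left_mono) auto
  then have "0 \<le> r"
    using assms by (simp add: r_def)
  have "0 \<le> q * (q - 2 * d - 4)"
    using assms by simp
  then have "r < q\<^sup>2 - 2 * q + 2"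
    using assms by (simp add: r_def algebra_simps power2_eq_square)
  moreover have "q\<^sup>2 * (d + 2 * q - 1) = (2 * q + d + 3) * (q\<^sup>2 - 2 * q + 2) + r"
    by (simp add: r_def algebra_simps power2_eq_square)
  ultimately have "(q\<^sup>2 * (d + 2 * q - 1)) div (q\<^sup>2 - 2 * q + 2) = 2 * q + d + 3"
    using \<open>0 \<le> r\<close> by (intro int_div_pos_eq[where r = r]) auto
  then show ?thesis
    unfolding Haem_ge_eq by (simp only: floor_divide_of_int_eq)
qed

text \<open>As a polynomial in \<open>x\<close>, \<open>R\<close> has leading coefficient
  \<open>v - y\<close>. Multiplying by it allows completing to the last product; the rest is free of
  \<open>x\<close> and factors. By \<open>Haem_ge_eq\<close> its middle factor is
  \<open>q^2 - 2*q + 2\<close> times \<open>Haem_ge G d - y\<close>.\<close>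

lemma R_poly_eq:
  "(q ^ 4 - y) * R_poly G x y d
   = y * (q\<^sup>2 * (d + 2 * q - 1) - y * (q\<^sup>2 - 2 * q + 2)) * (y * (q - 1)\<^sup>2 + q\<^sup>2 * ((q - 1)\<^sup>2 - d))
     + (y * (srg_k G - d) - x * (q ^ 4 - y)) * (y * (srg_k G - d) - (x + 1) * (q ^ 4 - y))"
  unfolding R_poly_def v_eq lambda_eq mu_eq k_eq by algebra

lemma R_poly_neg_at_floor_Haem:
  assumes "0 \<le> d" "2 * d + 4 \<le> q"
  shows "R_poly G (2 * q + d - 2) (2 * q + d + 3) d < 0"
proof -
  \<comment> \<open>In terms of \<open>t\<close> the hypothesis reads \<open>t \<ge> 0\<close>, and
    \<open>-R\<close> becomes a polynomial in \<open>t\<close> and \<open>d\<close> with only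
    positive coefficients and constant term 6. The chosen \<open>x\<close> is the quotient of
    \<open>y * (k - d)\<close> by \<open>v - y\<close>.\<close>
  define t where "t = q - 2 * d - 4"
  have q: "q = t + 2 * d + 4" and "t \<ge> 0"
    using assms by (auto simp: t_def)
  have "R_poly G (2 * q + d - 2) (2 * q + d + 3) d =
      - (2 * t ^ 3 * d + 2 * t ^ 3 + 8 * t\<^sup>2 * d\<^sup>2 + 22 * t\<^sup>2 * d + 10 * t\<^sup>2
         + 8 * t * d ^ 3 + 38 * t * d\<^sup>2 + 52 * t * d + 14 * t
         + 4 * d ^ 3 + 22 * d\<^sup>2 + 32 * d + 6)"
    unfolding R_poly_def v_eq lambda_eq mu_eq k_eq q by algebra
  also have "\<dots> < 0"
    unfolding neg_less_0_iff_less using \<open>t \<ge> 0\<close> \<open>0 \<le> d\<close>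
    by (intro add_nonneg_pos add_nonneg_nonneg mult_nonneg_nonneg) auto
  finally show ?thesis .
qed

lemma k_gt:
  assumes "0 \<le> d" "2 * d + 4 \<le> q"
  shows "d < srg_k G"
proof -
  have "q\<^sup>2 + 1 \<le> srg_k G"
    unfolding k_eq using q_ge mult_right_mono[of 1 "(q - 1)\<^sup>2" "q\<^sup>2 + 1"] by simp
  moreover have "q \<le> q\<^sup>2"
    using q_ge by (simp add: power2_eq_square)
  ultimately show ?thesis
    using assms by linarith
qed

lemma R_poly_neg_above_Haem:
  assumes "0 \<le> d" "2 * d + 4 \<le> q" and y: "2 * q + d + 4 \<le> y" "y < q ^ 4"
  shows "\<exists>x. R_poly G x y d < 0"
proof
  let ?D = "q\<^sup>2 - 2 * q + 2" and ?w = "q ^ 4 - y" and ?s = "y * (srg_k G - d)"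
  let ?x = "?s div ?w"
  have w: "?w > 0"
    using y by simp
  have "?D = (q - 1)\<^sup>2 + 1"
    by (simp add: algebra_simps power2_eq_square)
  then have D: "?D > 0"
    using zero_le_power2[of "q - 1"] by linarith
  \<comment> \<open>The difference of the two sides compared next is
    \<open>q * (q - 2*d - 4) + 2*d + 8\<close>.\<close>
  have "0 \<le> q * (q - 2 * d - 4)"
    using assms by simp
  then have "q\<^sup>2 * (d + 2 * q - 1) < (2 * q + d + 4) * ?D"
    using assms by (simp add: algebra_simps power2_eq_square)
  also have "\<dots> \<le> y * ?D"
    using y D by (intro mult_right_mono) auto
  finally have A: "q\<^sup>2 * (d + 2 * q - 1) - y * ?D < 0"
    by simp
  have "d \<le> q - 1"
    using assms(1,2) by simp
  also have "\<dots> \<le> (q - 1)\<^sup>2"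
    using q_ge by (intro self_le_power) auto
  finally have "(q - 1)\<^sup>2 - d \<ge> 0"
    by simp
  moreover have "y * (q - 1)\<^sup>2 > 0"
    using y assms q_ge by simp
  ultimately have B: "y * (q - 1)\<^sup>2 + q\<^sup>2 * ((q - 1)\<^sup>2 - d) > 0"
    by (intro add_pos_nonneg) auto
  have C: "y * (q\<^sup>2 * (d + 2 * q - 1) - y * ?D) * (y * (q - 1)\<^sup>2 + q\<^sup>2 * ((q - 1)\<^sup>2 - d)) < 0"
    using A B y assms by (intro mult_neg_pos mult_pos_neg) auto
  \<comment> \<open>The two factors are the remainder and the remainder minus the divisor, so their
    signs are opposite or one vanishes.\<close>
  have "?s - ?x * ?w = ?s mod ?w"
    by (simp add: minus_div_mult_eq_mod)
  then have "?s - ?x * ?w \<ge> 0" "?s - (?x + 1) * ?w \<le> 0"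
    using pos_mod_bound[OF w, of ?s] pos_mod_sign[OF w, of ?s]
    unfolding distrib_right mult_1 by linarith+
  then have "(?s - ?x * ?w) * (?s - (?x + 1) * ?w) \<le> 0"
    by (rule mult_nonneg_nonpos)
  then have "?w * R_poly G ?x y d < 0"
    unfolding R_poly_eq using C by linarith
  then show "R_poly G ?x y d < 0"
    using w by (simp add: mult_less_0_iff)
qed

text \<open>At \<open>y = v\<close> the quadratic term in \<open>x\<close> vanishes and the slope is
  \<open>-2 * v * (k - d)\<close>, negative because \<open>d < k\<close>; a large \<open>x\<close>
  suffices.\<close>

lemma R_poly_neg_at_v:
  assumes "0 \<le> d" "2 * d + 4 \<le> q"
  shows "\<exists>x. R_poly G x (srg_v G) d < 0"
proof -
  define c where "c = R_poly G 0 (srg_v G) d"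
  define a where "a = srg_v G * (srg_k G - d)"
  have "a > 0"
    using k_gt[OF assms] q_ge by (simp add: a_def v_eq)
  \<comment> \<open>With \<open>a \<ge> 1\<close>, the bounds \<open>x \<ge> c\<close> and
    \<open>x \<ge> 1\<close> give \<open>c - 2*x*a \<le> -x < 0\<close>.\<close>
  define x where "x = max 1 c"
  have "x * 1 \<le> x * a"
    using \<open>a > 0\<close> by (intro mult_left_mono) (auto simp: x_def)
  moreover have "R_poly G x (srg_v G) d = c - 2 * (x * a)"
    by (simp add: R_poly_def a_def c_def algebra_simps)
  moreover have "c \<le> x" "1 \<le> x"
    by (auto simp: x_def)
  ultimately have "R_poly G x (srg_v G) d < 0"
    by linarith
  then show ?thesis ..
qed

lemma Rab_ge_less_floor_Haem_ge:
  assumes "0 \<le> d" "2 * d + 4 \<le> q"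
  shows "Rab_ge G d < \<lfloor>Haem_ge G d\<rfloor>"
  unfolding floor_Haem_ge[OF assms]
proof (rule Rab_ge_less)
  fix y
  assume y: "2 * q + d + 3 \<le> y" "y \<le> srg_v G"
  consider "y = 2 * q + d + 3" | "y = srg_v G" | "2 * q + d + 4 \<le> y" "y < q ^ 4"
    using y v_eq by linarith
  then show "\<exists>x. R_poly G x y d < 0"
    using R_poly_neg_at_floor_Haem R_poly_neg_at_v R_poly_neg_above_Haem assms by cases blast+
qed (use assms in auto)

end

theorem theorem6p15:
  fixes \<Lambda> :: real
    and \<Gamma> :: "nat \<Rightarrow> 'a pair_pre_digraph"
    and k \<mu> lam :: "nat \<Rightarrow> nat"
  assumes "\<Lambda> > 0"
    and k: "\<And>q. primepow q \<Longrightarrow> int (k q) = (int q - 1)\<^sup>2 * ((int q)\<^sup>2 + 1)"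
    and mu: "\<And>q. primepow q \<Longrightarrow> int (\<mu> q) = (int q - 1)\<^sup>2 * ((int q - 1)\<^sup>2 + 1)"
    and lam: "\<And>q. primepow q \<Longrightarrow> int (lam q) = int (\<mu> q) + (int q - 1)\<^sup>2 + 1 - 2 * int q"
    and srg: "\<And>q. primepow q \<Longrightarrow> strongly_regular (\<Gamma> q) (q ^ 4) (k q) (lam q) (\<mu> q)"
  shows "(\<forall>q. primepow q \<longrightarrow>
            srg_rho (\<Gamma> q) = (real q - 1)\<^sup>2 \<and> srg_sigma (\<Gamma> q) = 1 - 2 * real q) \<and>
         infinite {q. primepow q \<and>
            (\<forall>d::int. 0 \<le> d \<and> real_of_int d \<le> \<Lambda> \<longrightarrow> Rab_ge (\<Gamma> q) d < \<lfloor>Haem_ge (\<Gamma> q) d\<rfloor>)}"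
proof -
  have G: "cy1_graph (\<Gamma> q) (int q)" if q: "primepow q" for q
  proof -
    have "q > 1"
      using primepow_gt_Suc_0[OF q] by simp
    then show ?thesis
      using strongly_regular_params[OF srg[OF q]] k[OF q] mu[OF q] lam[OF q]
      by unfold_locales simp_all
  qed
  have "\<exists>q > m. primepow q \<and>
      (\<forall>d::int. 0 \<le> d \<and> real_of_int d \<le> \<Lambda> \<longrightarrow> Rab_ge (\<Gamma> q) d < \<lfloor>Haem_ge (\<Gamma> q) d\<rfloor>)" for m
  proof -
    \<comment> \<open>A prime beyond \<open>2 * \<Lambda> + 4\<close> meets the size condition for
      all \<open>d \<le> \<Lambda>\<close> at once.\<close>
    obtain q :: nat where "prime q" and q: "q > max m (nat \<lceil>2 * \<Lambda> + 4\<rceil>)"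
      using bigger_prime by blast
    interpret cy1_graph "\<Gamma> q" "int q"
      using G \<open>prime q\<close> by simp
    have "2 * d + 4 \<le> int q" if "real_of_int d \<le> \<Lambda>" for d
      using that q by linarith
    then show ?thesis
      using Rab_ge_less_floor_Haem_ge \<open>prime q\<close> q by (intro exI[of _ q]) auto
  qed
  then have "infinite {q. primepow q \<and>
      (\<forall>d::int. 0 \<le> d \<and> real_of_int d \<le> \<Lambda> \<longrightarrow> Rab_ge (\<Gamma> q) d < \<lfloor>Haem_ge (\<Gamma> q) d\<rfloor>)}"
    by (simp add: infinite_nat_iff_unbounded)
  then show ?thesis
    using G cy1_graph.srg_rho_eq cy1_graph.srg_sigma_eq by fastforce
qed

end
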